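(* Let $A\in\mathbb{R}^{n\times n}$, $B=[B_1\ \cdots\ B_m]\in\mathbb{R}^{n\times m}$ (columns $B_i$), $F\in\mathbb{R}^{n\times l}_+$, $E=[E_1^{\top}\ \cdots\ E_m^{\top}]^{\top}\in\mathbb{R}^{m\times n}_+$ (rows $E_i\neq 0$), $s\in\mathbb{R}^n$, $r\in\mathbb{R}^m$, $\gamma\in\mathbb{R}^l_+$, and let $A-|B|E$ be Metzler. Suppose $s-E^{\top}|r|>0$. Then $(s^{\top}-r^{\top}K,\ A-BK)$ is detectable for any $K\in\mathbb{R}^{m\times n}$ satisfying $|K|\le E$. Moreover, suppose that the following (equivalent) conditions hold: (i) the problem $\inf_{\mu}\sup_{w}\int_0^\infty[s^{\top}x+r^{\top}u-\gamma^{\top}w]\,d\tau$ subject to $\dot x=Ax+Bu+Fw$, $x(0)=x_0$, $u(t)=\mu(x(t))$, $|u|\le Ex$, $w\ge 0$, has a finite value for every $x_0\in\mathbb{R}^n_+$; (ii) there exists a unique $p\in\mathbb{R}^n_+$ which satisfies $0=s+A^{\top}p-E^{\top}|r+B^{\top}p|$ and $\gamma\ge F^{\top}p$ and which is minimal among all solutions $\hat p\in\mathbb{R}^n_+$ of these relations in the sense that $p\le\hat p$. If $K$ satisfies $$K\in\begin{bmatrix}\operatorname{sign}(r_1+p^{\top}B_1)E_1\\ \vdots\\ \operatorname{sign}(r_m+p^{\top}B_m)E_m\end{bmatrix}$$ with $p$ as in (ii), then $u(t)=-Kx(t)$ stabilizes the system, i.e. $A-BK$ is Hurwitz.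
   Context: Inequalities between vectors or matrices are elementwise, $|X|$ denotes the elementwise absolute value, and $\mathbb{R}^n_+$, $\mathbb{R}^{m\times n}_+$ denote vectors/matrices with nonnegative entries. A square matrix is Metzler if its off-diagonal entries are nonnegative, and Hurwitz if all its eigenvalues have strictly negative real part. The signum is set-valued: $\operatorname{sign}(y)=\{+1\}$ if $y>0$, $\{-1\}$ if $y<0$, and $[-1,1]$ if $y=0$; the inclusion for $K$ means that the $i$-th row of $K$ is $\sigma E_i$ for some $\sigma\in\operatorname{sign}(r_i+p^{\top}B_i)$. A pair $(C,M)$ (system $\dot x=Mx$, $y=Cx$) is detectable if all unobservable states are (asymptotically) stable. In the control problem, $\mu$ ranges over all (potentially nonlinear and time-varying) state-feedback policies producing $u(t)\in\mathbb{R}^m$ with $|u(t)|\le Ex(t)$, and $w$ ranges over all nonnegative disturbance functions of time with values in $\mathbb{R}^l$ for which the dynamics and cost are well defined.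
   Formalization: Detectability is stated for nonnegative states only (all unobservable states x ≥ 0 are stable); over all of ℝⁿ it fails, e.g. A = I, B = 0, E = [1 1], s = (1,1), r = 0, K = 0, where the state (1,−1) is unobservable and unstable. *)

theory Defs
  imports "HOL-Analysis.Analysis"
begin

(* On real^'n and real^'n^'m the library's order and absolute value are elementwise.
   The library's strict order is not (x < y only means x <= y and x ~= y), so strict
   inequalities between vectors are written out by components. *)

definition metzler :: "real^'n^'n \<Rightarrow> bool" where
  "metzler M \<longleftrightarrow> (\<forall>i j. i \<noteq> j \<longrightarrow> 0 \<le> M $ i $ j)"

definition cmatrix :: "real^'n^'m \<Rightarrow> complex^'n^'m" where
  "cmatrix M = (\<chi> i j. complex_of_real (M $ i $ j))"

definition hurwitz :: "real^'n^'n \<Rightarrow> bool" where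
  "hurwitz M \<longleftrightarrow>
     (\<forall>(ev::complex) v. v \<noteq> 0 \<and> cmatrix M *v v = ev *s v \<longrightarrow> Re ev < 0)"

definition sign_set :: "real \<Rightarrow> real set" where
  "sign_set y = (if y > 0 then {1} else if y < 0 then {-1} else {-1..1})"


subsection \<open>Detectability\<close>

definition lin_trajectory :: "real^'n^'n \<Rightarrow> real^'n \<Rightarrow> (real \<Rightarrow> real^'n) \<Rightarrow> bool" where
  "lin_trajectory M x0 x \<longleftrightarrow> x 0 = x0 \<and>
     (\<forall>t\<ge>0. (x has_vector_derivative (M *v x t)) (at t within {0..}))"

definition unobservable_state :: "real^'n^'q \<Rightarrow> real^'n^'n \<Rightarrow> real^'n \<Rightarrow> bool" where
  "unobservable_state C M x0 \<longleftrightarrow>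
     (\<forall>x. lin_trajectory M x0 x \<longrightarrow> (\<forall>t\<ge>0. C *v x t = 0))"

definition stable_state :: "real^'n^'n \<Rightarrow> real^'n \<Rightarrow> bool" where
  "stable_state M x0 \<longleftrightarrow> (\<forall>x. lin_trajectory M x0 x \<longrightarrow> (x \<longlongrightarrow> 0) at_top)"

(* S is the state space of the system. For positive systems it is the nonnegative orthant.
   The choice matters: for C = [1 1] and M = mat 1 the state (1,-1) is unobservable and
   unstable, whereas no nonzero nonnegative state is unobservable. *)
definition detectable :: "(real^'n) set \<Rightarrow> real^'n^'q \<Rightarrow> real^'n^'n \<Rightarrow> bool" where
  "detectable S C M \<longleftrightarrow> (\<forall>x0\<in>S. unobservable_state C M x0 \<longrightarrow> stable_state M x0)"


subsection \<open>The minimax problem\<close>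

definition disturbance :: "(real \<Rightarrow> real^'l) \<Rightarrow> bool" where
  "disturbance w \<longleftrightarrow> (\<forall>t\<ge>0. 0 \<le> w t) \<and> (\<forall>T\<ge>0. w absolutely_integrable_on {0..T})"

(* Caratheodory solutions of x' = A x + B u + F w, u(t) = \<mu> t (x t), with locally
   integrable input; disturbances need not be continuous. *)
definition closed_loop ::
  "real^'n^'n \<Rightarrow> real^'m^'n \<Rightarrow> real^'l^'n \<Rightarrow> (real \<Rightarrow> real^'n \<Rightarrow> real^'m)
     \<Rightarrow> (real \<Rightarrow> real^'l) \<Rightarrow> real^'n \<Rightarrow> (real \<Rightarrow> real^'n) \<Rightarrow> bool" where
  "closed_loop A B F \<mu> w x0 x \<longleftrightarrow>
     continuous_on {0..} x \<and>
     (\<forall>T\<ge>0. (\<lambda>t. \<mu> t (x t)) absolutely_integrable_on {0..T}) \<and>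
     (\<forall>T\<ge>0. ((\<lambda>t. A *v x t + B *v \<mu> t (x t) + F *v w t) has_integral (x T - x0)) {0..T})"

(* Without the existence requirement, a policy whose closed loop has no solution at all
   would make the supremum over w empty and hence the value of the problem -\<infinity>. *)
definition admissible_policy ::
  "real^'n^'n \<Rightarrow> real^'m^'n \<Rightarrow> real^'l^'n \<Rightarrow> real^'n^'m \<Rightarrow> real^'n
     \<Rightarrow> (real \<Rightarrow> real^'n \<Rightarrow> real^'m) \<Rightarrow> bool" where
  "admissible_policy A B F E x0 \<mu> \<longleftrightarrow>
     (\<forall>w. disturbance w \<longrightarrow>
        (\<exists>x. closed_loop A B F \<mu> w x0 x) \<and>
        (\<forall>x. closed_loop A B F \<mu> w x0 x \<longrightarrow> (\<forall>t\<ge>0. \<bar>\<mu> t (x t)\<bar> \<le> E *v x t)))"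

definition has_cost ::
  "real^'n \<Rightarrow> real^'m \<Rightarrow> real^'l \<Rightarrow> (real \<Rightarrow> real^'n \<Rightarrow> real^'m)
     \<Rightarrow> (real \<Rightarrow> real^'l) \<Rightarrow> (real \<Rightarrow> real^'n) \<Rightarrow> ereal \<Rightarrow> bool" where
  "has_cost s r \<gamma> \<mu> w x c \<longleftrightarrow>
     ((\<lambda>T. ereal (integral {0..T} (\<lambda>t. s \<bullet> x t + r \<bullet> \<mu> t (x t) - \<gamma> \<bullet> w t))) \<longlongrightarrow> c) at_top"

definition minimax_value ::
  "real^'n^'n \<Rightarrow> real^'m^'n \<Rightarrow> real^'l^'n \<Rightarrow> real^'n^'m
     \<Rightarrow> real^'n \<Rightarrow> real^'m \<Rightarrow> real^'l \<Rightarrow> real^'n \<Rightarrow> ereal" where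
  "minimax_value A B F E s r \<gamma> x0 =
     (INF \<mu>\<in>{\<mu>. admissible_policy A B F E x0 \<mu>}.
        Sup {c. \<exists>w x. disturbance w \<and> closed_loop A B F \<mu> w x0 x \<and> has_cost s r \<gamma> \<mu> w x c})"

definition finite_minimax_value ::
  "real^'n^'n \<Rightarrow> real^'m^'n \<Rightarrow> real^'l^'n \<Rightarrow> real^'n^'m
     \<Rightarrow> real^'n \<Rightarrow> real^'m \<Rightarrow> real^'l \<Rightarrow> bool" where
  "finite_minimax_value A B F E s r \<gamma> \<longleftrightarrow>
     (\<forall>x0\<ge>0. \<bar>minimax_value A B F E s r \<gamma> x0\<bar> \<noteq> \<infinity>)"


subsection \<open>The algebraic condition\<close>

definition bellman_solution ::
  "real^'n^'n \<Rightarrow> real^'m^'n \<Rightarrow> real^'l^'n \<Rightarrow> real^'n^'m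
     \<Rightarrow> real^'n \<Rightarrow> real^'m \<Rightarrow> real^'l \<Rightarrow> real^'n \<Rightarrow> bool" where
  "bellman_solution A B F E s r \<gamma> p \<longleftrightarrow>
     0 \<le> p \<and>
     0 = s + transpose A *v p - transpose E *v \<bar>r + transpose B *v p\<bar> \<and>
     transpose F *v p \<le> \<gamma>"

definition minimal_bellman_solution ::
  "real^'n^'n \<Rightarrow> real^'m^'n \<Rightarrow> real^'l^'n \<Rightarrow> real^'n^'m
     \<Rightarrow> real^'n \<Rightarrow> real^'m \<Rightarrow> real^'l \<Rightarrow> real^'n \<Rightarrow> bool" where
  "minimal_bellman_solution A B F E s r \<gamma> p \<longleftrightarrow>
     bellman_solution A B F E s r \<gamma> p \<and>
     (\<forall>p'. bellman_solution A B F E s r \<gamma> p' \<longrightarrow> p \<le> p')"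

definition optimal_gain ::
  "real^'m^'n \<Rightarrow> real^'n^'m \<Rightarrow> real^'m \<Rightarrow> real^'n \<Rightarrow> real^'n^'m \<Rightarrow> bool" where
  "optimal_gain B E r p K \<longleftrightarrow>
     (\<forall>i. \<exists>\<sigma>\<in>sign_set (r $ i + p \<bullet> column i B). row i K = \<sigma> *\<^sub>R row i E)"

end

theory Submission
  imports Defs
begin

text \<open>
  Since \<open>|K| \<le> E\<close>, the cost vector \<open>c = s - K\<^sup>T r\<close> dominates \<open>s - E\<^sup>T|r| > 0\<close>. A nonnegative state
  \<open>x0\<close> with \<open>c \<bullet> x0 = 0\<close> is therefore \<open>0\<close>, and \<open>0\<close> is an equilibrium. For an optimal gain the Bellman
  equation reads \<open>(A - B K)\<^sup>T p = - c < 0\<close>, so \<open>p\<close> is a linear Lyapunov function for the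
  Metzler matrix \<open>M = A - B K\<close>: if \<open>M v = \<lambda> v\<close>, then \<open>Re \<lambda> |v| \<le> M |v|\<close> and pairing with \<open>p\<close> gives
  \<open>Re \<lambda> (p \<bullet> |v|) \<le> - c \<bullet> |v| < 0\<close>, hence \<open>Re \<lambda> < 0\<close>.
\<close>

lemma inner_pos_nonneg_eq_0:
  fixes c x :: "real^'n"
  assumes "\<forall>i. 0 < c $ i" and "0 \<le> x" and "c \<bullet> x \<le> 0"
  shows "x = 0"
proof -
  have nonneg: "0 \<le> c $ i * x $ i" for i
    using assms(1,2) by (simp add: less_eq_vec_def less_imp_le)
  have "(\<Sum>i\<in>UNIV. c $ i * x $ i) = 0"
    using assms(3) nonneg by (intro antisym sum_nonneg) (auto simp: inner_vec_def)
  then have "c $ i * x $ i = 0" for i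
    using nonneg by (subst (asm) sum_nonneg_eq_0_iff) auto
  then show ?thesis
    using assms(1) by (auto simp: vec_eq_iff) (metis less_irrefl)
qed

text \<open>Gronwall: \<open>exp (- 2 L t) * (x t \<bullet> x t)\<close> is nonincreasing when \<open>L\<close> bounds the norm of \<open>M\<close>.\<close>

lemma lin_trajectory_zero:
  assumes "lin_trajectory M 0 x" and "0 \<le> t"
  shows "x t = 0"
proof -
  obtain L where L: "\<And>v. norm (M *v v) \<le> norm v * L"
    using bounded_linear.bounded[OF matrix_vector_mul_bounded_linear[of M]] by blast
  \<comment> \<open>The rate \<open>2 * L\<close> matches the growth of
    \<open>x t \<bullet> x t\<close>: its derivative \<open>2 * (x t \<bullet> (M *v x t))\<close>
    is at most \<open>2 * L * (x t \<bullet> x t)\<close> by Cauchy-Schwarz.\<close>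
  define g where "g t = exp (- (2 * L * t)) * (x t \<bullet> x t)" for t
  define g' where
    "g' t = exp (- (2 * L * t)) * (2 * (x t \<bullet> (M *v x t)) - 2 * L * (x t \<bullet> x t))" for t
  have deriv: "(g has_real_derivative g' u) (at u within {0..t})" if "u \<in> {0..t}" for u
  proof -
    have "(x has_vector_derivative M *v x u) (at u within {0..t})"
      using assms(1) that unfolding lin_trajectory_def
      by (auto intro: has_vector_derivative_within_subset)
    then have "((\<lambda>t. x t \<bullet> x t) has_real_derivative 2 * (x u \<bullet> (M *v x u))) (at u within {0..t})"
      unfolding has_real_derivative_iff_has_vector_derivative has_vector_derivative_def
      by (auto intro!: derivative_eq_intros simp: inner_commute algebra_simps)
    then show ?thesis
      unfolding g_def g'_def by (auto intro!: derivative_eq_intros simp: algebra_simps)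
  qed
  have g'_le: "g' u \<le> 0" for u
  proof -
    have "x u \<bullet> (M *v x u) \<le> norm (x u) * norm (M *v x u)"
      by (rule norm_cauchy_schwarz)
    also have "\<dots> \<le> norm (x u) * (norm (x u) * L)"
      by (intro mult_left_mono L) simp
    also have "\<dots> = L * (x u \<bullet> x u)"
      by (simp add: dot_square_norm power2_eq_square)
    finally show ?thesis
      unfolding g'_def by (simp add: mult_nonneg_nonpos)
  qed
  have "g t \<le> g 0"
  proof (intro DERIV_nonpos_imp_decreasing_open[OF assms(2)])
    show "continuous_on {0..t} g"
      using deriv by (rule DERIV_continuous_on)
    fix u assume "0 < u" "u < t"
    then have "(g has_real_derivative g' u) (at u)"
      using deriv[of u] by (simp add: at_within_Icc_at)
    then show "\<exists>y. (g has_real_derivative y) (at u) \<and> y \<le> 0"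
      using g'_le by blast
  qed
  also have "g 0 = 0"
    using assms(1) by (simp add: g_def lin_trajectory_def)
  finally show ?thesis
    by (simp add: g_def mult_le_0_iff) (metis inner_ge_zero inner_eq_zero_iff antisym)
qed

lemma detectable_nonneg_if_output_pos:
  fixes C :: "real^'n^1"
  assumes "\<forall>j. 0 < C $ 1 $ j"
  shows "detectable {x. 0 \<le> x} C M"
  unfolding detectable_def stable_state_def
proof (intro ballI impI allI)
  fix x0 x
  assume x0: "x0 \<in> {x. 0 \<le> x}" and "unobservable_state C M x0" and x: "lin_trajectory M x0 x"
  \<comment> \<open>The output at time 0 alone already forces the initial state to vanish.\<close>
  then have "C *v x 0 = 0" and "x 0 = x0"
    by (auto simp: unobservable_state_def lin_trajectory_def)
  then have "C $ 1 \<bullet> x0 = 0"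
    by (metis matrix_vector_mul_component zero_index)
  then have "x0 = 0"
    using assms x0 by (intro inner_pos_nonneg_eq_0[of "C $ 1"]) auto
  then have "eventually (\<lambda>t. x t = 0) at_top"
    using lin_trajectory_zero x by (auto intro: eventually_mono[OF eventually_ge_at_top[of 0]])
  then show "(x \<longlongrightarrow> 0) at_top"
    by (rule tendsto_eventually)
qed

text \<open>The diagonal entry may be negative, so it is moved to the eigenvalue side, where
  \<open>Re z \<le> norm z\<close> applies to \<open>ev - M $ i $ i\<close>. The remaining
  coefficients are nonnegative, so the triangle inequality passes to absolute values without
  changing them.\<close>

lemma metzler_eigenvector_le:
  fixes M :: "real^'n^'n" and v :: "complex^'n"
  assumes "metzler M" and "cmatrix M *v v = ev *s v"
  shows "Re ev * norm (v $ i) \<le> (\<Sum>j\<in>UNIV. M $ i $ j * norm (v $ j))"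
proof -
  have "ev * v $ i = (\<Sum>j\<in>UNIV. of_real (M $ i $ j) * v $ j)"
    using arg_cong[OF assms(2), of "\<lambda>w. w $ i"]
    by (simp add: matrix_vector_mult_def cmatrix_def)
  also have "\<dots> = of_real (M $ i $ i) * v $ i + (\<Sum>j\<in>UNIV - {i}. of_real (M $ i $ j) * v $ j)"
    by (rule sum.remove) auto
  finally have eq: "(ev - of_real (M $ i $ i)) * v $ i
      = (\<Sum>j\<in>UNIV - {i}. of_real (M $ i $ j) * v $ j)"
    by (simp add: algebra_simps)
  have "(Re ev - M $ i $ i) * norm (v $ i) \<le> norm (ev - of_real (M $ i $ i)) * norm (v $ i)"
    using complex_Re_le_cmod[of "ev - of_real (M $ i $ i)"] by (intro mult_right_mono) auto
  also have "\<dots> = norm (\<Sum>j\<in>UNIV - {i}. of_real (M $ i $ j) * v $ j)"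
    by (metis eq norm_mult)
  also have "\<dots> \<le> (\<Sum>j\<in>UNIV - {i}. M $ i $ j * norm (v $ j))"
    using assms(1) by (intro sum_norm_le) (auto simp: norm_mult metzler_def)
  finally show ?thesis
    by (subst sum.remove[of _ i]) (auto simp: algebra_simps)
qed

lemma metzler_hurwitzI:
  fixes M :: "real^'n^'n"
  assumes "metzler M" and "0 \<le> p" and neg: "\<forall>j. (transpose M *v p) $ j < 0"
  shows "hurwitz M"
  unfolding hurwitz_def
proof (intro allI impI)
  fix ev :: complex and v :: "complex^'n"
  assume ev: "v \<noteq> 0 \<and> cmatrix M *v v = ev *s v"
  define a :: "real^'n" where "a = (\<chi> i. norm (v $ i))"
  have a: "0 \<le> a" "a \<noteq> 0"
    using ev by (auto simp: a_def less_eq_vec_def vec_eq_iff)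
  have "Re ev * (p \<bullet> a) = (\<Sum>i\<in>UNIV. p $ i * (Re ev * norm (v $ i)))"
    by (simp add: inner_vec_def a_def sum_distrib_left mult_ac)
  also have "\<dots> \<le> (\<Sum>i\<in>UNIV. p $ i * (M *v a) $ i)"
    using metzler_eigenvector_le[OF assms(1)] ev assms(2)
    by (intro sum_mono mult_left_mono) (auto simp: matrix_vector_mult_def a_def less_eq_vec_def)
  also have "\<dots> = (transpose M *v p) \<bullet> a"
    by (simp add: dot_lmul_matrix) (simp add: inner_vec_def)
  \<comment> \<open>Contraposition: were the product nonnegative, the strictly positive vector
    \<open>- (transpose M *v p)\<close> would force \<open>a = 0\<close>.\<close>
  also have "\<dots> < 0"
    using inner_pos_nonneg_eq_0[of "- (transpose M *v p)" a] neg a by fastforce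
  \<comment> \<open>Since \<open>p \<bullet> a\<close> is nonnegative, the strictly negative product
    leaves only \<open>Re ev < 0\<close>.\<close>
  finally show "Re ev < 0"
    using inner_nonneg_nonneg[OF assms(2) a(1)] by (auto simp: mult_less_0_iff)
qed

text \<open>Under \<open>u = - K x\<close> the running cost
  \<open>s \<bullet> x + r \<bullet> u\<close> is the inner product of \<open>x\<close> with this
  vector.\<close>

lemma closed_loop_cost_pos:
  fixes E K :: "real^'n^'m"
  assumes "\<bar>K\<bar> \<le> E" and "\<forall>j. 0 < (s - transpose E *v \<bar>r\<bar>) $ j"
  shows "0 < (s - transpose K *v r) $ j"
proof -
  have "(transpose K *v r) $ j \<le> (transpose E *v \<bar>r\<bar>) $ j"
    unfolding matrix_vector_mult_def transpose_def vec_lambda_beta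
  proof (rule sum_mono)
    fix i
    have "K $ i $ j * r $ i \<le> \<bar>K $ i $ j\<bar> * \<bar>r $ i\<bar>"
      by (metis abs_ge_self abs_mult)
    also have "\<dots> \<le> E $ i $ j * \<bar>r\<bar> $ i"
      using assms(1) by (auto simp: less_eq_vec_def abs_vec_def intro!: mult_right_mono)
    finally show "K $ i $ j * r $ i \<le> E $ i $ j * \<bar>r\<bar> $ i" .
  qed
  moreover have "0 < s $ j - (transpose E *v \<bar>r\<bar>) $ j"
    using assms(2) by simp
  ultimately show ?thesis by simp
qed

text \<open>Entrywise, \<open>A - B ** K\<close> dominates
  \<open>A - \<bar>B\<bar> ** E\<close>.\<close>

lemma metzler_closed_loop:
  fixes B :: "real^'m^'n" and E K :: "real^'n^'m"
  assumes "\<bar>K\<bar> \<le> E" and "metzler (A - \<bar>B\<bar> ** E)"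
  shows "metzler (A - B ** K)"
  unfolding metzler_def
proof (intro allI impI)
  fix i j :: 'n
  assume "i \<noteq> j"
  have "(B ** K) $ i $ j \<le> (\<bar>B\<bar> ** E) $ i $ j"
    unfolding matrix_matrix_mult_def vec_lambda_beta
  proof (rule sum_mono)
    fix k
    have "B $ i $ k * K $ k $ j \<le> \<bar>B $ i $ k\<bar> * \<bar>K $ k $ j\<bar>"
      by (metis abs_ge_self abs_mult)
    also have "\<dots> \<le> \<bar>B\<bar> $ i $ k * E $ k $ j"
      using assms(1) by (auto simp: less_eq_vec_def abs_vec_def intro!: mult_left_mono)
    finally show "B $ i $ k * K $ k $ j \<le> \<bar>B\<bar> $ i $ k * E $ k $ j" .
  qed
  moreover have "0 \<le> (A - \<bar>B\<bar> ** E) $ i $ j"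
    using assms(2) \<open>i \<noteq> j\<close> by (simp add: metzler_def)
  ultimately show "0 \<le> (A - B ** K) $ i $ j" by simp
qed

lemma sign_set_mult: "\<sigma> \<in> sign_set y \<Longrightarrow> \<sigma> * y = \<bar>y\<bar>"
  by (auto simp: sign_set_def split: if_splits)

lemma sign_set_abs_le: "\<sigma> \<in> sign_set y \<Longrightarrow> \<bar>\<sigma>\<bar> \<le> 1"
  by (auto simp: sign_set_def split: if_splits)

lemma optimal_gainE:
  assumes "optimal_gain B E r p K"
  obtains \<sigma> where "\<sigma> \<in> sign_set ((r + transpose B *v p) $ i)" and "\<And>j. K $ i $ j = \<sigma> * E $ i $ j"
proof -
  obtain \<sigma> where "\<sigma> \<in> sign_set (r $ i + p \<bullet> column i B)" and "row i K = \<sigma> *\<^sub>R row i E"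
    using assms by (auto simp: optimal_gain_def)
  then show ?thesis
    by (intro that[of \<sigma>])
      (auto simp: column_def inner_vec_def matrix_vector_mult_def transpose_def row_def
        vec_eq_iff mult.commute)
qed

lemma optimal_gain_abs_le:
  assumes "optimal_gain B E r p K" and "0 \<le> E"
  shows "\<bar>K\<bar> \<le> E"
proof -
  have "\<bar>K $ i $ j\<bar> \<le> E $ i $ j" for i j
  proof -
    obtain \<sigma> where \<sigma>: "\<sigma> \<in> sign_set ((r + transpose B *v p) $ i)" "K $ i $ j = \<sigma> * E $ i $ j"
      using optimal_gainE[OF assms(1)] by blast
    have "0 \<le> E $ i $ j"
      using assms(2) by (simp add: less_eq_vec_def)
    then show ?thesis
      using sign_set_abs_le[OF \<sigma>(1)] by (simp add: \<sigma>(2) abs_mult mult_left_le_one_le)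
  qed
  then show ?thesis
    by (simp add: less_eq_vec_def abs_vec_def)
qed

text \<open>The signs make every term of the sum as large as \<open>\<bar>K\<bar> \<le> E\<close>
  permits, so the gain attains the absolute value in the Bellman equation. Where a component of
  \<open>r + transpose B *v p\<close> is zero, both sides vanish for any choice of sign.\<close>

lemma optimal_gain_transpose_mult:
  assumes "optimal_gain B E r p K"
  shows "transpose K *v (r + transpose B *v p) = transpose E *v \<bar>r + transpose B *v p\<bar>"
proof -
  have "K $ i $ j * (r + transpose B *v p) $ i = E $ i $ j * \<bar>r + transpose B *v p\<bar> $ i" for i j
  proof -
    obtain \<sigma> where \<sigma>: "\<sigma> \<in> sign_set ((r + transpose B *v p) $ i)" "K $ i $ j = \<sigma> * E $ i $ j"
      using optimal_gainE[OF assms] by blast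
    show ?thesis
      using sign_set_mult[OF \<sigma>(1)] unfolding \<sigma>(2) abs_vec_def vec_lambda_beta
      by (metis mult.assoc mult.commute)
  qed
  then show ?thesis
    \<comment> \<open>Only the outer products are expanded; \<open>transpose B *v p\<close> stays
      folded to match the entrywise equation.\<close>
    unfolding matrix_vector_mult_def[of "transpose K"] matrix_vector_mult_def[of "transpose E"]
    by (simp only: transpose_def[of K] transpose_def[of E] vec_lambda_beta)
qed

text \<open>With the gain fixed, the absolute value becomes linear and the Bellman equation turns
  into a Lyapunov equation for \<open>p\<close>.\<close>

lemma bellman_closed_loop:
  assumes "bellman_solution A B F E s r \<gamma> p" and "optimal_gain B E r p K"
  shows "transpose (A - B ** K) *v p = - (s - transpose K *v r)"
proof -
  have "transpose (A - B ** K) = transpose A - transpose K ** transpose B"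
    by (simp flip: matrix_transpose_mul) (simp add: transpose_def vec_eq_iff)
  \<comment> \<open>Adding and subtracting \<open>transpose K *v r\<close> completes the argument of
    the absolute value.\<close>
  then have "transpose (A - B ** K) *v p
      = transpose A *v p - transpose K *v (r + transpose B *v p) + transpose K *v r"
    by (simp add: matrix_vector_mult_diff_rdistrib matrix_vector_right_distrib
        matrix_vector_mul_assoc del: transpose_matrix_vector)
  also have "transpose A *v p - transpose K *v (r + transpose B *v p) = - s"
    using assms(1) unfolding optimal_gain_transpose_mult[OF assms(2)] bellman_solution_def
    by (metis add_diff_eq neg_eq_iff_add_eq_0)
  finally show ?thesis by simp
qed

theorem corollary7:
  fixes A :: "real^'n^'n" and B :: "real^'m^'n" and F :: "real^'l^'n" and E :: "real^'n^'m"
    and s :: "real^'n" and r :: "real^'m" and \<gamma> :: "real^'l"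
  assumes "0 \<le> F" and "0 \<le> E" and "\<forall>i. row i E \<noteq> 0" and "0 \<le> \<gamma>"
    and "metzler (A - \<bar>B\<bar> ** E)"
    and "\<forall>i. 0 < (s - transpose E *v \<bar>r\<bar>) $ i"
  shows "(\<forall>K. \<bar>K\<bar> \<le> E \<longrightarrow>
            detectable {x. 0 \<le> x} (rowvector s - rowvector r ** K :: real^'n^1) (A - B ** K)) \<and>
         (finite_minimax_value A B F E s r \<gamma> \<or> (\<exists>!p. minimal_bellman_solution A B F E s r \<gamma> p) \<longrightarrow>
            (\<forall>p K. minimal_bellman_solution A B F E s r \<gamma> p \<and> optimal_gain B E r p K \<longrightarrow>
               hurwitz (A - B ** K)))"
proof (intro conjI impI allI)
  fix K :: "real^'n^'m"
  assume K: "\<bar>K\<bar> \<le> E"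
  have "(rowvector s - rowvector r ** K :: real^'n^1) $ 1 = s - transpose K *v r"
    by (simp add: vec_eq_iff rowvector_def matrix_matrix_mult_def matrix_vector_mult_def
        transpose_def mult.commute)
  then show "detectable {x. 0 \<le> x} (rowvector s - rowvector r ** K :: real^'n^1) (A - B ** K)"
    using closed_loop_cost_pos[OF K assms(6)] by (intro detectable_nonneg_if_output_pos) simp
next
  fix p K
  assume "minimal_bellman_solution A B F E s r \<gamma> p \<and> optimal_gain B E r p K"
  then have p: "bellman_solution A B F E s r \<gamma> p" and K: "optimal_gain B E r p K"
    by (auto simp: minimal_bellman_solution_def)
  have KE: "\<bar>K\<bar> \<le> E"
    using K assms(2) by (rule optimal_gain_abs_le)
  have "(transpose (A - B ** K) *v p) $ j < 0" for j
    using closed_loop_cost_pos[OF KE assms(6), of j] bellman_closed_loop[OF p K] by simp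
  moreover have "0 \<le> p"
    using p by (simp add: bellman_solution_def)
  ultimately show "hurwitz (A - B ** K)"
    using metzler_closed_loop[OF KE assms(5)] by (intro metzler_hurwitzI) auto
qed

end
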